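(* Let $\Phi$ denote the standard normal CDF and let $\eta_0 := 2\left(1-\Phi(\sqrt{2\log 2})\right)\approx 0.239$. Let $\epsilon>0$ and $\eta<\eta_0-\epsilon$, and let $X\in\mathbb{R}^{m\times n}$ have i.i.d. $N(0,1)$ entries with $m> C\frac{n}{\epsilon^2}$ for a sufficiently large absolute constant $C$. Then with probability $1-e^{-\Omega(\epsilon^2 m)}$ the matrix $X$ has the following property: for any $w^*\in\mathbb{R}^n$, any $\zeta\in\mathbb{R}^m$ with $\|\zeta\|_0\leq\eta m$, any $d\in\mathbb{R}^m$, and $y=Xw^*+d+\zeta$, the estimator \[ \widehat{w} := \operatorname{argmin}_{w\in\mathbb{R}^n}\|y-Xw\|_1 \] satisfies \[ \|\widehat{w}-w^*\|_2 \leq O\left(\frac{\|d\|_1}{\epsilon m}\right), \] where the constant in $O(\cdot)$ is absolute.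
   Context: $\|\zeta\|_0$ denotes the number of nonzero entries of $\zeta$. The vector $\zeta$ represents adversarial sparse corruptions and $d$ is arbitrary dense noise. *)

theory Defs
  imports "HOL-Probability.Probability"
begin

definition std_normal :: "real measure" where
  "std_normal = density lborel std_normal_density"

definition Phi :: "real \<Rightarrow> real" where
  "Phi x = measure std_normal {..x}"

definition eta0 :: real where
  "eta0 = 2 * (1 - Phi (sqrt (2 * ln 2)))"

definition gauss_matrix :: "nat \<Rightarrow> nat \<Rightarrow> (nat \<times> nat \<Rightarrow> real) measure" where
  "gauss_matrix m n = PiM ({..<m} \<times> {..<n}) (\<lambda>_. std_normal)"

definition mat_vec :: "nat \<Rightarrow> (nat \<times> nat \<Rightarrow> real) \<Rightarrow> (nat \<Rightarrow> real) \<Rightarrow> nat \<Rightarrow> real" where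
  "mat_vec n X w = (\<lambda>i. \<Sum>j<n. X (i, j) * w j)"

definition norm1 :: "nat \<Rightarrow> (nat \<Rightarrow> real) \<Rightarrow> real" where
  "norm1 k v = (\<Sum>i<k. \<bar>v i\<bar>)"

definition norm2 :: "nat \<Rightarrow> (nat \<Rightarrow> real) \<Rightarrow> real" where
  "norm2 k v = sqrt (\<Sum>i<k. (v i)\<^sup>2)"

definition norm0 :: "nat \<Rightarrow> (nat \<Rightarrow> real) \<Rightarrow> nat" where
  "norm0 k v = card {i\<in>{..<k}. v i \<noteq> 0}"

definition good_matrix ::
  "nat \<Rightarrow> nat \<Rightarrow> real \<Rightarrow> real \<Rightarrow> real \<Rightarrow> (nat \<times> nat \<Rightarrow> real) \<Rightarrow> bool" where
  "good_matrix m n eta eps K X \<longleftrightarrow>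
    (\<forall>wstar zeta d what.
       real (norm0 m zeta) \<le> eta * real m \<longrightarrow>
       (let y = (\<lambda>i. mat_vec n X wstar i + d i + zeta i) in
         (\<forall>w. norm1 m (\<lambda>i. y i - mat_vec n X what i) \<le> norm1 m (\<lambda>i. y i - mat_vec n X w i))
         \<longrightarrow> norm2 n (\<lambda>j. what j - wstar j) \<le> K * norm1 m d / (eps * real m)))"

end

theory Submission
  imports Defs "HOL-Analysis.Function_Metric"
begin

text \<open>
  Let \<open>t = sqrt (2 ln 2)\<close> and \<open>f x = min |x| (2 t - |x|)\<close>. For every set \<open>S\<close> of corrupted rows,
  \<open>\<Sum>\<^bsub>i \<notin> S\<^esub> |z i| - \<Sum>\<^bsub>i \<in> S\<^esub> |z i| \<ge> \<Sum>\<^bsub>i\<^esub> f (z i) - 2 t |S|\<close>, and the threshold \<open>t\<close> is chosen such that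
  \<open>E f(g) = 2 t \<eta>\<^sub>0\<close> for a standard normal \<open>g\<close>. So it suffices that
  \<open>\<Sum>\<^bsub>i\<^esub> f ((X v) i) \<ge> m (E f(g) - t \<epsilon>)\<close> uniformly over unit vectors \<open>v\<close>.
  Since \<open>f\<close> is 1-Lipschitz with \<open>f 0 = 0\<close>, symmetrization and contraction, applied to one row at a time,
  bound the exponential moment of the supremum of \<open>\<lambda> \<Sum>\<^bsub>i\<^esub> (E f(g) - f ((X v) i))\<close> by that of
  \<open>2 \<lambda> \<Sum>\<^bsub>i\<^esub> (X v) i\<close>, which is at most \<open>exp (4 \<lambda>\<^sup>2 m) 2\<^bsup>n/2\<^esup>\<close>. Markov's inequality concludes; no net
  is needed, and this is what avoids a factor \<open>log (1/\<epsilon>)\<close> in the sample size.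
\<close>

section \<open>The standard normal measure and its products\<close>

lemma sets_std_normal [measurable_cong, simp]: "sets std_normal = sets borel"
  by (simp add: std_normal_def)

lemma space_std_normal [simp]: "space std_normal = UNIV"
  by (simp add: std_normal_def)

lemma prob_space_std_normal: "prob_space std_normal"
  unfolding std_normal_def by (rule prob_space_normal_density) simp

lemma prob_space_PiM_std_normal: "prob_space (Pi\<^sub>M I (\<lambda>_. std_normal))"
  by (intro prob_space_PiM prob_space_std_normal)

lemma product_sigma_finite_std_normal: "product_sigma_finite (\<lambda>_. std_normal)"
  unfolding product_sigma_finite_def
  using prob_space_imp_sigma_finite[OF prob_space_std_normal] by simp

section \<open>Symmetrization and contraction\<close>

text \<open>The pair \<open>(p, q)\<close> is weakly majorized by \<open>(P, Q)\<close>, and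
  \<open>exp\<close> is increasing and convex. In the ordered case with \<open>Q < p\<close>, the
  entry \<open>q\<close> may be raised to \<open>P + Q - p\<close>; the claim is then the expansion
  of \<open>(exp P - exp p) * (1 - exp (Q - p)) \<ge> 0\<close>.\<close>

lemma exp_weak_majorization:
  fixes p q P Q :: real
  assumes "p \<le> max P Q" "q \<le> max P Q" "p + q \<le> P + Q"
  shows "exp p + exp q \<le> exp P + exp Q"
proof -
  have *: "exp p + exp q \<le> exp P + exp Q"
    if "q \<le> p" "Q \<le> P" "p \<le> P" "p + q \<le> P + Q" for p q P Q :: real
  proof (cases "p \<le> Q")
    case True
    then show ?thesis using that by (intro add_mono) auto
  next
    case False
    have "exp q \<le> exp (P + Q - p)" using that by simp
    also have "exp (P + Q - p) = exp P * exp (Q - p)"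
      by (simp add: exp_add [symmetric] algebra_simps)
    finally have q: "exp q \<le> exp P * exp (Q - p)" .
    have "0 \<le> (exp P - exp p) * (1 - exp (Q - p))"
      using that False by (intro mult_nonneg_nonneg) auto
    also have "\<dots> = exp P - exp p - exp P * exp (Q - p) + exp p * exp (Q - p)"
      by (simp add: algebra_simps)
    also have "exp p * exp (Q - p) = exp Q"
      by (simp add: exp_add [symmetric])
    finally show ?thesis using q by simp
  qed
  show ?thesis
    using *[of q p Q P] *[of q p P Q] *[of p q Q P] *[of p q P Q] assms
    by (cases "q \<le> p"; cases "Q \<le> P") (auto simp: max_def add.commute)
qed

text \<open>The contraction principle for one random sign, whose two values give the two summands.
  If \<open>v\<close> and \<open>w\<close> attain the maxima on the left, then
  \<open>?p + ?q\<close> is at most \<open>a v + a w + \<bar>x v - x w\<bar>\<close>, and the sign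
  of \<open>x v - x w\<close> decides which of them competes in \<open>?P\<close> and which in
  \<open>?Q\<close>. The hypothesis \<open>abs\<close> bounds each of \<open>?p\<close> and
  \<open>?q\<close> by the larger of \<open>?P\<close> and \<open>?Q\<close>.\<close>

lemma exp_Max_contraction:
  fixes a x y :: "'v \<Rightarrow> real"
  assumes T: "finite T" "T \<noteq> {}"
    and abs: "\<And>v. v \<in> T \<Longrightarrow> \<bar>y v\<bar> \<le> \<bar>x v\<bar>"
    and lip: "\<And>v w. v \<in> T \<Longrightarrow> w \<in> T \<Longrightarrow> \<bar>y v - y w\<bar> \<le> \<bar>x v - x w\<bar>"
  shows "exp (Max ((\<lambda>v. a v + y v) ` T)) + exp (Max ((\<lambda>v. a v - y v) ` T))
       \<le> exp (Max ((\<lambda>v. a v + x v) ` T)) + exp (Max ((\<lambda>v. a v - x v) ` T))"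
    (is "exp ?p + exp ?q \<le> exp ?P + exp ?Q")
proof (rule exp_weak_majorization)
  have "?p \<in> (\<lambda>v. a v + y v) ` T" using T by (intro Max_in) auto
  then obtain v where v: "v \<in> T" "?p = a v + y v" by auto
  have "?q \<in> (\<lambda>v. a v - y v) ` T" using T by (intro Max_in) auto
  then obtain w where w: "w \<in> T" "?q = a w - y w" by auto
  have P: "a u + x u \<le> ?P" and Q: "a u - x u \<le> ?Q" if "u \<in> T" for u
    using that T by (auto intro: Max_ge)
  show "?p \<le> max ?P ?Q"
    unfolding v(2) using abs[OF v(1)] P[OF v(1)] Q[OF v(1)] by linarith
  show "?q \<le> max ?P ?Q"
    unfolding w(2) using abs[OF w(1)] P[OF w(1)] Q[OF w(1)] by linarith
  show "?p + ?q \<le> ?P + ?Q"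
    unfolding v(2) w(2)
    using lip[OF v(1) w(1)] P[OF v(1)] Q[OF v(1)] P[OF w(1)] Q[OF w(1)] by linarith
qed

text \<open>Jensen's inequality. With values in \<open>ennreal\<close> it also covers a
  non-integrable \<open>exp (X x)\<close>, where the right side is infinite, so exponentials need no
  integrability check later.\<close>

lemma (in prob_space) exp_expectation_le:
  assumes "integrable M X"
  shows "ennreal (exp (expectation X)) \<le> (\<integral>\<^sup>+ x. ennreal (exp (X x)) \<partial>M)"
proof (cases "integrable M (\<lambda>x. exp (X x))")
  case True
  have "exp (expectation X) \<le> expectation (\<lambda>x. exp (X x))"
    using assms True by (intro jensens_inequality[where I = UNIV]) (auto intro: exp_convex)
  then show ?thesis
    using True by (simp add: nn_integral_eq_integral)
next
  case False
  have [measurable]: "X \<in> borel_measurable M" using assms by auto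
  have "(\<integral>\<^sup>+ x. ennreal (exp (X x)) \<partial>M) = \<infinity>"
  proof (rule ccontr)
    assume "(\<integral>\<^sup>+ x. ennreal (exp (X x)) \<partial>M) \<noteq> \<infinity>"
    then have "integrable M (\<lambda>x. exp (X x))"
      by (intro integrableI_nonneg) (auto simp: less_top)
    with False show False by simp
  qed
  then show ?thesis by simp
qed

lemma integrable_Max:
  fixes f :: "'v \<Rightarrow> 'a \<Rightarrow> real"
  assumes "finite T" "T \<noteq> {}" "\<And>v. v \<in> T \<Longrightarrow> integrable M (f v)"
  shows "integrable M (\<lambda>x. Max ((\<lambda>v. f v x) ` T))"
  using assms
proof (induction T rule: finite_ne_induct)
  case (insert v T)
  then have "(\<lambda>x. Max ((\<lambda>v. f v x) ` insert v T)) = (\<lambda>x. max (f v x) (Max ((\<lambda>v. f v x) ` T)))"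
    by auto
  with insert show ?case by simp
qed simp

text \<open>The case of one row, the other rows being held fixed inside the offsets
  \<open>a\<close>. The random sign never appears as a variable: its two values give the two
  integrals on the right and the factor 2 on the left. The coefficient grows from \<open>l\<close>
  to \<open>2 * l\<close> because each centred term is the average of one term with
  \<open>2 * l * \<mu>\<close> and one with \<open>- 2 * l * g (Y v x)\<close>.\<close>

lemma (in prob_space) exp_Max_symmetrization_contraction:
  fixes Y :: "'v \<Rightarrow> 'a \<Rightarrow> real" and g :: "real \<Rightarrow> real"
  assumes T: "finite T" "T \<noteq> {}" and l: "0 \<le> l"
    and Y: "\<And>v. v \<in> T \<Longrightarrow> integrable M (Y v)"
    and g0: "g 0 = 0" and lip: "\<And>x y. \<bar>g x - g y\<bar> \<le> \<bar>x - y\<bar>"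
    and mean: "\<And>v. v \<in> T \<Longrightarrow> expectation (\<lambda>x. g (Y v x)) = \<mu>"
  shows "2 * (\<integral>\<^sup>+ x. ennreal (exp (Max ((\<lambda>v. a v + l * (\<mu> - g (Y v x))) ` T))) \<partial>M)
      \<le> (\<integral>\<^sup>+ x. ennreal (exp (Max ((\<lambda>v. a v + 2 * l * Y v x) ` T))) \<partial>M)
        + (\<integral>\<^sup>+ x. ennreal (exp (Max ((\<lambda>v. a v - 2 * l * Y v x) ` T))) \<partial>M)"
proof -
  have "continuous_on UNIV g"
  proof (rule lipschitz_on_continuous_on)
    show "1-lipschitz_on UNIV g" by (rule lipschitz_onI) (auto simp: dist_real_def lip)
  qed
  then have g_meas [measurable]: "g \<in> borel_measurable borel"
    by (rule borel_measurable_continuous_onI)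
  have Y_meas [measurable]: "Y v \<in> borel_measurable M" if "v \<in> T" for v using Y[OF that] by auto
  have g_abs: "\<bar>g x\<bar> \<le> \<bar>x\<bar>" for x using lip[of x 0] g0 by simp
  have gY: "integrable M (\<lambda>x. g (Y v x))" if "v \<in> T" for v
    by (rule Bochner_Integration.integrable_bound[OF Y[OF that]]) (use g_abs that in auto)
  define p where "p = (\<lambda>x. Max ((\<lambda>v. a v + 2 * l * g (Y v x)) ` T))"
  define q where "q = (\<lambda>x. Max ((\<lambda>v. a v - 2 * l * g (Y v x)) ` T))"
  have p: "integrable M p" and q: "integrable M q"
    unfolding p_def q_def using T gY by (auto intro!: integrable_Max)
  note [measurable] = borel_measurable_integrable[OF p] borel_measurable_integrable[OF q]
  \<comment> \<open>Symmetrization without a ghost sample: the mean \<open>\<mu>\<close> is absorbed into \<open>expectation p\<close>, a constant.\<close>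
  have le_pq: "Max ((\<lambda>v. a v + l * (\<mu> - g (Y v x))) ` T) \<le> (expectation p + q x) / 2" for x
  proof (rule Max.boundedI)
    fix z assume "z \<in> (\<lambda>v. a v + l * (\<mu> - g (Y v x))) ` T"
    then obtain v where v: "v \<in> T" "z = a v + l * (\<mu> - g (Y v x))" by auto
    have "a v + 2 * l * \<mu> = expectation (\<lambda>x. a v + 2 * l * g (Y v x))"
      using mean[OF v(1)] gY[OF v(1)] by (simp add: prob_space)
    also have "\<dots> \<le> expectation p"
      using gY[OF v(1)] p T v(1) by (intro integral_mono) (auto simp: p_def intro: Max_ge)
    finally have "a v + 2 * l * \<mu> \<le> expectation p" .
    moreover have "a v - 2 * l * g (Y v x) \<le> q x"
      using T v(1) by (auto simp: q_def intro: Max_ge)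
    ultimately show "z \<le> (expectation p + q x) / 2"
      unfolding v(2) by (simp add: algebra_simps)
  qed (use T in auto)
  have "2 * (\<integral>\<^sup>+ x. ennreal (exp (Max ((\<lambda>v. a v + l * (\<mu> - g (Y v x))) ` T))) \<partial>M)
      = (\<integral>\<^sup>+ x. 2 * ennreal (exp (Max ((\<lambda>v. a v + l * (\<mu> - g (Y v x))) ` T))) \<partial>M)"
    using T by (intro nn_integral_cmult[symmetric]) measurable
  also have "\<dots> \<le> (\<integral>\<^sup>+ x. ennreal (exp (expectation p)) + ennreal (exp (q x)) \<partial>M)"
  proof (rule nn_integral_mono)
    fix x
    have "2 * exp (Max ((\<lambda>v. a v + l * (\<mu> - g (Y v x))) ` T)) \<le> 2 * exp ((expectation p + q x) / 2)"
      using le_pq by simp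
    \<comment> \<open>Midpoint convexity of \<open>exp\<close>, obtained from majorization with both
      left entries equal to the mean.\<close>
    also have "\<dots> \<le> exp (expectation p) + exp (q x)"
      using exp_weak_majorization[of "(expectation p + q x) / 2" "expectation p" "q x" "(expectation p + q x) / 2"]
      by (simp add: max_def)
    finally show "2 * ennreal (exp (Max ((\<lambda>v. a v + l * (\<mu> - g (Y v x))) ` T)))
        \<le> ennreal (exp (expectation p)) + ennreal (exp (q x))"
      by (metis ennreal_leI ennreal_mult' ennreal_numeral ennreal_plus exp_ge_zero zero_le_numeral)
  qed
  also have "\<dots> = ennreal (exp (expectation p)) + (\<integral>\<^sup>+ x. ennreal (exp (q x)) \<partial>M)"
    by (subst nn_integral_add) (auto simp: emeasure_space_1)
  \<comment> \<open>Jensen puts \<open>p\<close> back under an integral; \<open>p\<close> and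
    \<open>q\<close> are then evaluated at the same \<open>x\<close>, and the contraction applies
    pointwise.\<close>
  also have "\<dots> \<le> (\<integral>\<^sup>+ x. ennreal (exp (p x)) \<partial>M) + (\<integral>\<^sup>+ x. ennreal (exp (q x)) \<partial>M)"
    by (intro add_right_mono exp_expectation_le p)
  also have "\<dots> = (\<integral>\<^sup>+ x. ennreal (exp (p x) + exp (q x)) \<partial>M)"
    by (subst nn_integral_add[symmetric]) auto
  also have "\<dots> \<le> (\<integral>\<^sup>+ x. ennreal (exp (Max ((\<lambda>v. a v + 2 * l * Y v x) ` T))
      + exp (Max ((\<lambda>v. a v - 2 * l * Y v x) ` T))) \<partial>M)"
  proof (intro nn_integral_mono ennreal_leI)
    fix x
    show "exp (p x) + exp (q x) \<le> exp (Max ((\<lambda>v. a v + 2 * l * Y v x) ` T))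
      + exp (Max ((\<lambda>v. a v - 2 * l * Y v x) ` T))"
      unfolding p_def q_def
    proof (rule exp_Max_contraction[OF T])
      fix v w
      show "\<bar>2 * l * g (Y v x)\<bar> \<le> \<bar>2 * l * Y v x\<bar>"
        using g_abs l by (simp add: abs_mult mult_left_mono)
      have "\<bar>2 * l * (g (Y v x) - g (Y w x))\<bar> \<le> \<bar>2 * l * (Y v x - Y w x)\<bar>"
        using lip l unfolding abs_mult by (intro mult_left_mono) auto
      then show "\<bar>2 * l * g (Y v x) - 2 * l * g (Y w x)\<bar> \<le> \<bar>2 * l * Y v x - 2 * l * Y w x\<bar>"
        by (simp add: algebra_simps)
    qed
  qed
  also have "\<dots> = (\<integral>\<^sup>+ x. ennreal (exp (Max ((\<lambda>v. a v + 2 * l * Y v x) ` T))) \<partial>M)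
        + (\<integral>\<^sup>+ x. ennreal (exp (Max ((\<lambda>v. a v - 2 * l * Y v x) ` T))) \<partial>M)"
    using T by (subst nn_integral_add[symmetric]) (auto intro!: borel_measurable_Max)
  finally show ?thesis .
qed

section \<open>Standard Gaussian vectors and matrices\<close>

lemma distributed_component_std_normal:
  assumes "i \<in> I"
  shows "distributed (Pi\<^sub>M I (\<lambda>_. std_normal)) lborel (\<lambda>x. x i) (normal_density 0 1)"
proof -
  have "distr (Pi\<^sub>M I (\<lambda>_. std_normal)) lborel (\<lambda>x. x i)
      = distr (Pi\<^sub>M I (\<lambda>_. std_normal)) std_normal (\<lambda>x. x i)"
    by (intro distr_cong) auto
  also have "\<dots> = std_normal"
    using assms prob_space_std_normal by (intro distr_PiM_component) auto
  finally show ?thesis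
    using assms by (auto simp: distributed_def std_normal_def)
qed

lemma distributed_linear_std_normal:
  fixes v :: "'i \<Rightarrow> real"
  assumes I: "finite I" and s: "0 < s" "(\<Sum>i\<in>I. (v i)\<^sup>2) = s\<^sup>2"
  shows "distributed (Pi\<^sub>M I (\<lambda>_. std_normal)) lborel (\<lambda>x. \<Sum>i\<in>I. v i * x i) (normal_density 0 s)"
proof -
  let ?M = "Pi\<^sub>M I (\<lambda>_. std_normal)"
  interpret prob_space ?M by (rule prob_space_PiM_std_normal)
  \<comment> \<open>The addition theorem for independent normals asks for positive deviations and a
    nonempty index set, so zero coefficients are dropped first.\<close>
  define J where "J = {i \<in> I. v i \<noteq> 0}"
  have J: "finite J" "J \<subseteq> I" using I by (auto simp: J_def)
  have sumJ: "(\<Sum>i\<in>J. (v i)\<^sup>2) = s\<^sup>2"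
    unfolding s(2)[symmetric] using I by (intro sum.mono_neutral_left) (auto simp: J_def)
  have "J \<noteq> {}" using sumJ s(1) by auto
  have comp: "distr ?M borel (\<lambda>x. x i) = std_normal" if "i \<in> I" for i
  proof -
    have "distr ?M borel (\<lambda>x. x i) = distr ?M lborel (\<lambda>x. x i)"
      by (intro distr_cong) auto
    then show ?thesis
      using distributed_component_std_normal[OF that] by (simp add: distributed_def std_normal_def)
  qed
  \<comment> \<open>Independence amounts to the joint law of the coordinates in \<open>J\<close>, a
    marginal of the product measure, being the product of their laws.\<close>
  have "indep_vars (\<lambda>_. borel) (\<lambda>i x. x i) J"
  proof (subst indep_vars_iff_distr_eq_PiM'[OF \<open>J \<noteq> {}\<close>])
    show "random_variable borel (\<lambda>x. x i)" if "i \<in> J" for i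
    proof -
      have [measurable]: "i \<in> I" using that J by auto
      show ?thesis by measurable
    qed
    have "distr ?M (\<Pi>\<^sub>M i\<in>J. borel) (\<lambda>x. \<lambda>i\<in>J. x i)
        = distr ?M (Pi\<^sub>M J (\<lambda>_. std_normal)) (\<lambda>x. restrict x J)"
      by (intro distr_cong refl sets_PiM_cong) auto
    also have "\<dots> = Pi\<^sub>M J (\<lambda>_. std_normal)"
      using J by (intro product_prob_space.distr_PiM_restrict_finite product_prob_spaceI
          prob_space_std_normal)
    also have "\<dots> = (\<Pi>\<^sub>M i\<in>J. distr ?M borel (\<lambda>x. x i))"
      using J comp by (intro PiM_cong) auto
    finally show "distr ?M (\<Pi>\<^sub>M i\<in>J. borel) (\<lambda>x. \<lambda>i\<in>J. x i) = (\<Pi>\<^sub>M i\<in>J. distr ?M borel (\<lambda>x. x i))" .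
  qed
  then have "indep_vars (\<lambda>_. borel) (\<lambda>i x. v i * x i) J"
    by (rule indep_vars_compose2) auto
  then have "distributed ?M lborel (\<lambda>x. \<Sum>i\<in>J. v i * x i)
      (normal_density (\<Sum>i\<in>J. 0) (sqrt (\<Sum>i\<in>J. \<bar>v i\<bar>\<^sup>2)))"
  proof (rule sum_indep_normal[OF J(1) \<open>J \<noteq> {}\<close>])
    fix i assume "i \<in> J"
    then have "i \<in> I" "v i \<noteq> 0" by (auto simp: J_def)
    then show "0 < \<bar>v i\<bar>" "distributed ?M lborel (\<lambda>x. v i * x i) (normal_density 0 \<bar>v i\<bar>)"
      using normal_density_affine[OF distributed_component_std_normal, of i "v i" 0] by auto
  qed
  moreover have "(\<lambda>x. \<Sum>i\<in>J. v i * x i) = (\<lambda>x. \<Sum>i\<in>I. v i * x i)"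
    using I by (intro ext sum.mono_neutral_left) (auto simp: J_def)
  ultimately show ?thesis
    using sumJ s(1) by simp
qed

lemma distr_uminus_std_normal: "distr std_normal std_normal uminus = std_normal"
proof -
  interpret prob_space std_normal by (rule prob_space_std_normal)
  have "distributed std_normal lborel (\<lambda>x. x) (normal_density 0 1)"
    by (simp add: distributed_def std_normal_def distr_id2)
  from normal_density_affine[OF this, of "-1" 0]
  have "distr std_normal lborel uminus = std_normal"
    by (simp add: distributed_def std_normal_def)
  moreover have "distr std_normal std_normal uminus = distr std_normal lborel uminus"
    by (intro distr_cong) auto
  ultimately show ?thesis by simp
qed

text \<open>Holds because each factor is symmetric; it will identify the two sign branches of the
  symmetrized bound. The form \<open>compose I uminus\<close>, rather than plain negation, keeps the
  points extensional.\<close>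

lemma nn_integral_PiM_std_normal_uminus:
  assumes "finite I" and [measurable]: "f \<in> borel_measurable (Pi\<^sub>M I (\<lambda>_. std_normal))"
  shows "(\<integral>\<^sup>+ x. f (compose I uminus x) \<partial>Pi\<^sub>M I (\<lambda>_. std_normal)) = (\<integral>\<^sup>+ x. f x \<partial>Pi\<^sub>M I (\<lambda>_. std_normal))"
proof -
  have [measurable]: "compose I uminus \<in> Pi\<^sub>M I (\<lambda>_. std_normal) \<rightarrow>\<^sub>M Pi\<^sub>M I (\<lambda>_. std_normal)"
    unfolding compose_def by measurable
  have "distr (Pi\<^sub>M I (\<lambda>_. std_normal)) (Pi\<^sub>M I (\<lambda>_. std_normal)) (compose I uminus)
      = Pi\<^sub>M I (\<lambda>_. std_normal)"
    using assms(1) prob_space_std_normal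
    by (subst distr_PiM_finite_prob_space') (auto simp: distr_uminus_std_normal)
  then have "(\<integral>\<^sup>+ x. f x \<partial>Pi\<^sub>M I (\<lambda>_. std_normal))
    = (\<integral>\<^sup>+ x. f x \<partial>distr (Pi\<^sub>M I (\<lambda>_. std_normal)) (Pi\<^sub>M I (\<lambda>_. std_normal)) (compose I uminus))"
    by simp
  also have "\<dots> = (\<integral>\<^sup>+ x. f (compose I uminus x) \<partial>Pi\<^sub>M I (\<lambda>_. std_normal))"
    by (rule nn_integral_distr) auto
  finally show ?thesis by simp
qed

text \<open>A linear form with unit coefficient vector is standard normal, so \<open>g\<close> has
  the same mean for every \<open>v\<close>, as the one-row bound requires. Negating \<open>x\<close>
  turns the second integral of that bound into the first, and the factor 2 cancels.\<close>

lemma exp_Max_comparison_linear: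
  fixes u :: "'v \<Rightarrow> 'i \<Rightarrow> real" and g :: "real \<Rightarrow> real"
  assumes I: "finite I" and T: "finite T" "T \<noteq> {}" and l: "0 \<le> l"
    and u: "\<And>v. v \<in> T \<Longrightarrow> (\<Sum>i\<in>I. (u v i)\<^sup>2) = 1"
    and g0: "g 0 = 0" and lip: "\<And>x y. \<bar>g x - g y\<bar> \<le> \<bar>x - y\<bar>"
    and g_meas [measurable]: "g \<in> borel_measurable borel"
  shows "(\<integral>\<^sup>+ x. ennreal (exp (Max ((\<lambda>v. a v + l * ((\<integral>y. g y \<partial>std_normal) - g (\<Sum>i\<in>I. u v i * x i))) ` T)))
          \<partial>Pi\<^sub>M I (\<lambda>_. std_normal))
      \<le> (\<integral>\<^sup>+ x. ennreal (exp (Max ((\<lambda>v. a v + 2 * l * (\<Sum>i\<in>I. u v i * x i)) ` T)))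
          \<partial>Pi\<^sub>M I (\<lambda>_. std_normal))" (is "?L \<le> ?R")
proof -
  let ?M = "Pi\<^sub>M I (\<lambda>_. std_normal)"
  let ?Y = "\<lambda>v x. \<Sum>i\<in>I. u v i * x i"
  interpret prob_space ?M by (rule prob_space_PiM_std_normal)
  have Y: "distributed ?M lborel (?Y v) (normal_density 0 1)" if "v \<in> T" for v
    using u[OF that] by (intro distributed_linear_std_normal I) auto
  have "2 * ?L \<le> ?R + (\<integral>\<^sup>+ x. ennreal (exp (Max ((\<lambda>v. a v - 2 * l * ?Y v x) ` T))) \<partial>?M)"
  proof (rule exp_Max_symmetrization_contraction[OF T l _ g0 lip])
    fix v assume v: "v \<in> T"
    show "integrable ?M (?Y v)"
    proof (intro Bochner_Integration.integrable_sum integrable_mult_right)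
      fix i assume "i \<in> I"
      then show "integrable ?M (\<lambda>x. x i)"
        using distributed_integrable[OF distributed_component_std_normal, of i I "\<lambda>x. x"]
          integrable_std_normal_moment[of 1] by simp
    qed
    have "(\<integral>y. g y \<partial>std_normal) = (\<integral>y. normal_density 0 1 y * g y \<partial>lborel)"
      unfolding std_normal_def by (subst integral_density) auto
    also have "\<dots> = expectation (\<lambda>x. g (?Y v x))"
      using Y[OF v] by (intro distributed_integral) auto
    finally show "expectation (\<lambda>x. g (?Y v x)) = (\<integral>y. g y \<partial>std_normal)" by simp
  qed
  also have "(\<integral>\<^sup>+ x. ennreal (exp (Max ((\<lambda>v. a v - 2 * l * ?Y v x) ` T))) \<partial>?M)
    = (\<integral>\<^sup>+ x. ennreal (exp (Max ((\<lambda>v. a v + 2 * l * ?Y v (compose I uminus x)) ` T))) \<partial>?M)"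
    by (simp add: compose_def sum_negf)
  also have "\<dots> = ?R"
    using I T by (subst nn_integral_PiM_std_normal_uminus[where
          f = "\<lambda>x. ennreal (exp (Max ((\<lambda>v. a v + 2 * l * ?Y v x) ` T)))"]) auto
  also have "?R + ?R = 2 * ?R" by (rule mult_2[symmetric])
  finally have "2 * ?L \<le> 2 * ?R" .
  then show ?thesis
    using ennreal_mult_le_mult_iff[of 2 ?L ?R] by simp
qed

section \<open>Row-by-row comparison for Gaussian matrices\<close>

lemma measurable_PiM_std_normal_component:
  "p \<in> K \<Longrightarrow> (\<lambda>X. X p) \<in> borel_measurable (Pi\<^sub>M K (\<lambda>_. std_normal))"
  by measurable

lemma measurable_mat_vec:
  assumes "{i} \<times> {..<n} \<subseteq> K"
  shows "(\<lambda>X. mat_vec n X v i) \<in> borel_measurable (Pi\<^sub>M K (\<lambda>_. std_normal))"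
  unfolding mat_vec_def
  using assms by (intro borel_measurable_sum borel_measurable_times measurable_PiM_std_normal_component) auto

lemma mat_vec_cong:
  "(\<And>j. j < n \<Longrightarrow> X (i, j) = Y (i, j)) \<Longrightarrow> mat_vec n X v i = mat_vec n Y v i"
  by (simp add: mat_vec_def)

lemma mat_vec_merge:
  "{i} \<times> {..<n} \<subseteq> I \<Longrightarrow> mat_vec n (merge I J (x, y)) v i = mat_vec n x v i"
  "{i} \<times> {..<n} \<subseteq> J \<Longrightarrow> I \<inter> J = {} \<Longrightarrow> mat_vec n (merge I J (x, y)) v i = mat_vec n y v i"
  by (rule mat_vec_cong; force simp: merge_def)+

lemma sum_singleton_Times: "(\<Sum>p\<in>{i} \<times> B. h p) = (\<Sum>j\<in>B. h (i, j))"
proof -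
  have "{i} \<times> B = Pair i ` B" by auto
  then show ?thesis by (simp add: sum.reindex inj_on_def)
qed

lemma sum_Times_singleton: "(\<Sum>p\<in>A \<times> {j}. h p) = (\<Sum>i\<in>A. h (i, j))"
proof -
  have "A \<times> {j} = (\<lambda>i. (i, j)) ` A" by auto
  then show ?thesis by (simp add: sum.reindex inj_on_def)
qed

lemma mat_vec_eq_row_sum:
  "mat_vec n X v i = (\<Sum>p\<in>{i} \<times> {..<n}. v (snd p) * X p)"
  by (simp add: mat_vec_def sum_singleton_Times mult.commute)

text \<open>Induction on the number of rows by Fubini. The offset \<open>a\<close> stays arbitrary
  because it absorbs whatever is frozen: first the nonlinear sum over the earlier rows, then, in the
  induction hypothesis, the linear term of the last row.\<close>

lemma exp_Max_comparison_gauss_matrix: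
  fixes g :: "real \<Rightarrow> real" and T :: "(nat \<Rightarrow> real) set"
  assumes T: "finite T" "T \<noteq> {}" and l: "0 \<le> l"
    and unit: "\<And>v. v \<in> T \<Longrightarrow> (\<Sum>j<n. (v j)\<^sup>2) = 1"
    and g0: "g 0 = 0" and lip: "\<And>x y. \<bar>g x - g y\<bar> \<le> \<bar>x - y\<bar>"
    and g_meas [measurable]: "g \<in> borel_measurable borel"
    and \<mu>: "\<mu> = (\<integral>y. g y \<partial>std_normal)"
  shows "(\<integral>\<^sup>+ X. ennreal (exp (Max ((\<lambda>v. a v + l * (\<Sum>i<m. \<mu> - g (mat_vec n X v i))) ` T))) \<partial>gauss_matrix m n)
      \<le> (\<integral>\<^sup>+ X. ennreal (exp (Max ((\<lambda>v. a v + 2 * l * (\<Sum>i<m. mat_vec n X v i)) ` T))) \<partial>gauss_matrix m n)"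
proof (induction m arbitrary: a)
  case 0
  show ?case by simp
next
  case (Suc m)
  interpret product_sigma_finite "\<lambda>_ :: nat \<times> nat. std_normal" by (rule product_sigma_finite_std_normal)
  define I where "I = {m} \<times> {..<n}"
  define J where "J = {..<m} \<times> {..<n}"
  have IJ: "I \<inter> J = {}" "J \<inter> I = {}" "finite I" "finite J" and IJ_eq: "{..<Suc m} \<times> {..<n} = J \<union> I"
    by (auto simp: I_def J_def)
  have sub: "{m} \<times> {..<n} \<subseteq> I" "\<And>i. i < m \<Longrightarrow> {i} \<times> {..<n} \<subseteq> J"
    by (auto simp: I_def J_def)
  have [measurable]: "(\<lambda>X. mat_vec n X v i) \<in> borel_measurable (Pi\<^sub>M (J \<union> I) (\<lambda>_. std_normal))"
    if "i \<le> m" for v i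
    using that by (intro measurable_mat_vec) (auto simp: I_def J_def)
  \<comment> \<open>The hybrid \<open>?G\<close> has the last row already replaced by its linear counterpart.\<close>
  let ?F = "\<lambda>X. ennreal (exp (Max ((\<lambda>v. a v + l * (\<Sum>i<Suc m. \<mu> - g (mat_vec n X v i))) ` T)))"
  let ?G = "\<lambda>X. ennreal (exp (Max ((\<lambda>v. a v + l * (\<Sum>i<m. \<mu> - g (mat_vec n X v i))
                        + 2 * l * mat_vec n X v m) ` T)))"
  let ?H = "\<lambda>X. ennreal (exp (Max ((\<lambda>v. a v + 2 * l * (\<Sum>i<Suc m. mat_vec n X v i)) ` T)))"
  have F: "?F \<in> borel_measurable (Pi\<^sub>M (J \<union> I) (\<lambda>_. std_normal))"
    and G: "?G \<in> borel_measurable (Pi\<^sub>M (J \<union> I) (\<lambda>_. std_normal))"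
    and H: "?H \<in> borel_measurable (Pi\<^sub>M (J \<union> I) (\<lambda>_. std_normal))"
    using T by measurable
  have "(\<integral>\<^sup>+ X. ?F X \<partial>gauss_matrix (Suc m) n)
      = (\<integral>\<^sup>+ x. \<integral>\<^sup>+ y. ?F (merge J I (x, y)) \<partial>Pi\<^sub>M I (\<lambda>_. std_normal) \<partial>Pi\<^sub>M J (\<lambda>_. std_normal))"
    unfolding gauss_matrix_def IJ_eq by (rule product_nn_integral_fold[OF IJ(2,4,3) F])
  also have "\<dots> \<le> (\<integral>\<^sup>+ x. \<integral>\<^sup>+ y. ?G (merge J I (x, y)) \<partial>Pi\<^sub>M I (\<lambda>_. std_normal) \<partial>Pi\<^sub>M J (\<lambda>_. std_normal))"
  proof (rule nn_integral_mono)
    fix x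
    let ?a = "\<lambda>v. a v + l * (\<Sum>i<m. \<mu> - g (mat_vec n x v i))"
    have "(\<integral>\<^sup>+ y. ennreal (exp (Max ((\<lambda>v. ?a v + l * (\<mu> - g (mat_vec n y v m))) ` T))) \<partial>Pi\<^sub>M I (\<lambda>_. std_normal))
      \<le> (\<integral>\<^sup>+ y. ennreal (exp (Max ((\<lambda>v. ?a v + 2 * l * mat_vec n y v m) ` T))) \<partial>Pi\<^sub>M I (\<lambda>_. std_normal))"
      unfolding \<mu> mat_vec_eq_row_sum[of _ _ _ m] I_def[symmetric]
      using IJ T l g0 lip unit
      by (intro exp_Max_comparison_linear) (auto simp: I_def sum_singleton_Times)
    then show "(\<integral>\<^sup>+ y. ?F (merge J I (x, y)) \<partial>Pi\<^sub>M I (\<lambda>_. std_normal))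
        \<le> (\<integral>\<^sup>+ y. ?G (merge J I (x, y)) \<partial>Pi\<^sub>M I (\<lambda>_. std_normal))"
      using sub IJ by (simp add: mat_vec_merge algebra_simps)
  qed
  also have "\<dots> = (\<integral>\<^sup>+ X. ?G X \<partial>Pi\<^sub>M (J \<union> I) (\<lambda>_. std_normal))"
    by (rule product_nn_integral_fold[OF IJ(2,4,3) G, symmetric])
  also have "\<dots> = (\<integral>\<^sup>+ x. \<integral>\<^sup>+ y. ?G (merge I J (x, y)) \<partial>Pi\<^sub>M J (\<lambda>_. std_normal) \<partial>Pi\<^sub>M I (\<lambda>_. std_normal))"
    unfolding Un_commute[of J I] by (rule product_nn_integral_fold[OF IJ(1,3,4) G[unfolded Un_commute[of J I]]])
  also have "\<dots> \<le> (\<integral>\<^sup>+ x. \<integral>\<^sup>+ y. ?H (merge I J (x, y)) \<partial>Pi\<^sub>M J (\<lambda>_. std_normal) \<partial>Pi\<^sub>M I (\<lambda>_. std_normal))"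
  proof (rule nn_integral_mono)
    fix x
    show "(\<integral>\<^sup>+ y. ?G (merge I J (x, y)) \<partial>Pi\<^sub>M J (\<lambda>_. std_normal))
        \<le> (\<integral>\<^sup>+ y. ?H (merge I J (x, y)) \<partial>Pi\<^sub>M J (\<lambda>_. std_normal))"
      using Suc.IH[of "\<lambda>v. a v + 2 * l * mat_vec n x v m"] sub IJ
      by (simp add: mat_vec_merge algebra_simps gauss_matrix_def J_def[symmetric])
  qed
  also have "\<dots> = (\<integral>\<^sup>+ X. ?H X \<partial>Pi\<^sub>M (I \<union> J) (\<lambda>_. std_normal))"
    by (rule product_nn_integral_fold[OF IJ(1,3,4) H[unfolded Un_commute[of J I]], symmetric])
  also have "\<dots> = (\<integral>\<^sup>+ X. ?H X \<partial>gauss_matrix (Suc m) n)"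
    unfolding gauss_matrix_def IJ_eq Un_commute[of I J] ..
  finally show ?case .
qed

section \<open>Exponential moment of the linear process\<close>

text \<open>The column sum has variance \<open>m\<close>, and \<open>1 / (4 * m)\<close> is half the
  critical exponent \<open>1 / (2 * m)\<close>. Tilting the density by
  \<open>exp (x\<^sup>2 / (4 * m))\<close> doubles the variance at the price of a factor
  \<open>sqrt 2\<close>.\<close>

lemma nn_integral_exp_column_sum_sq:
  fixes j :: nat
  assumes "m > 0"
  shows "(\<integral>\<^sup>+ X. ennreal (exp ((\<Sum>i<m. X (i, j))\<^sup>2 / (4 * real m))) \<partial>Pi\<^sub>M ({..<m} \<times> {j}) (\<lambda>_. std_normal))
    = ennreal (sqrt 2)"
proof -
  let ?M = "Pi\<^sub>M ({..<m} \<times> {j}) (\<lambda>_. std_normal)"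
  have "distributed ?M lborel (\<lambda>X. \<Sum>p\<in>{..<m} \<times> {j}. 1 * X p) (normal_density 0 (sqrt m))"
    using assms by (intro distributed_linear_std_normal) auto
  moreover have "(\<Sum>p\<in>{..<m} \<times> {j}. 1 * X p) = (\<Sum>i<m. X (i, j))" for X :: "nat \<times> nat \<Rightarrow> real"
    by (simp add: sum_Times_singleton)
  ultimately have D: "distributed ?M lborel (\<lambda>X. \<Sum>i<m. X (i, j)) (normal_density 0 (sqrt m))"
    by simp
  have "(\<integral>\<^sup>+ X. ennreal (exp ((\<Sum>i<m. X (i, j))\<^sup>2 / (4 * real m))) \<partial>?M)
    = (\<integral>\<^sup>+ x. normal_density 0 (sqrt m) x * ennreal (exp (x\<^sup>2 / (4 * real m))) \<partial>lborel)"
    by (rule distributed_nn_integral[OF D, symmetric]) simp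
  also have "\<dots> = (\<integral>\<^sup>+ x. ennreal (sqrt 2) * ennreal (normal_density 0 (sqrt (2 * m)) x) \<partial>lborel)"
  proof (rule nn_integral_cong)
    fix x :: real
    have "- x\<^sup>2 / (2 * real m) + x\<^sup>2 / (4 * real m) = - x\<^sup>2 / (4 * real m)"
      using assms by (simp add: field_simps)
    then have "exp (- x\<^sup>2 / (2 * real m)) * exp (x\<^sup>2 / (4 * real m)) = exp (- x\<^sup>2 / (4 * real m))"
      by (simp flip: exp_add)
    then have "normal_density 0 (sqrt m) x * exp (x\<^sup>2 / (4 * real m))
        = sqrt 2 * normal_density 0 (sqrt (2 * m)) x"
      using assms by (simp add: normal_density_def real_sqrt_mult field_simps)
    then show "normal_density 0 (sqrt m) x * ennreal (exp (x\<^sup>2 / (4 * real m)))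
        = ennreal (sqrt 2) * ennreal (normal_density 0 (sqrt (2 * m)) x)"
      by (simp flip: ennreal_mult)
  qed
  also have "\<dots> = ennreal (sqrt 2) * (\<integral>\<^sup>+ x. ennreal (normal_density 0 (sqrt (2 * m)) x) \<partial>lborel)"
    by (rule nn_integral_cmult) simp
  also have "(\<integral>\<^sup>+ x. ennreal (normal_density 0 (sqrt (2 * m)) x) \<partial>lborel) = 1"
    using assms by (subst nn_integral_eq_integral)
      (auto simp: integrable_normal_density integral_normal_density)
  finally show ?thesis by simp
qed

text \<open>Columns are independent, so each contributes one factor \<open>sqrt 2\<close>; Fubini
  splits off the last one.\<close>

lemma nn_integral_exp_column_sums_sq:
  assumes "m > 0"
  shows "(\<integral>\<^sup>+ X. ennreal (exp (\<Sum>j<n. (\<Sum>i<m. X (i, j))\<^sup>2 / (4 * real m))) \<partial>gauss_matrix m n)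
    = ennreal (sqrt 2 ^ n)"
proof (induction n)
  case 0
  interpret prob_space "gauss_matrix m 0"
    unfolding gauss_matrix_def by (rule prob_space_PiM_std_normal)
  show ?case by (simp add: emeasure_space_1)
next
  case (Suc n)
  interpret product_sigma_finite "\<lambda>_ :: nat \<times> nat. std_normal" by (rule product_sigma_finite_std_normal)
  define I where "I = {..<m} \<times> {..<n}"
  define J where "J = {..<m} \<times> {n}"
  have IJ: "I \<inter> J = {}" "finite I" "finite J" and IJ_eq: "{..<m} \<times> {..<Suc n} = I \<union> J"
    by (auto simp: I_def J_def)
  have [measurable]: "(\<lambda>X. X (i, j)) \<in> borel_measurable (Pi\<^sub>M I (\<lambda>_. std_normal))" if "i < m" "j < n" for i j
    using that by (intro measurable_PiM_std_normal_component) (auto simp: I_def)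
  have [measurable]: "(\<lambda>X. X (i, j)) \<in> borel_measurable (Pi\<^sub>M (I \<union> J) (\<lambda>_. std_normal))" if "i < m" "j < Suc n" for i j
    using that by (intro measurable_PiM_std_normal_component) (auto simp: I_def J_def)
  let ?F = "\<lambda>n X. \<Sum>j<n. (\<Sum>i<m. X (i, j))\<^sup>2 / (4 * real m)"
  have [measurable]: "?F n \<in> borel_measurable (Pi\<^sub>M I (\<lambda>_. std_normal))"
    by measurable
  have F: "(\<lambda>X. ennreal (exp (?F (Suc n) X))) \<in> borel_measurable (Pi\<^sub>M (I \<union> J) (\<lambda>_. std_normal))"
    by measurable
  have merge: "?F (Suc n) (merge I J (x, y)) = ?F n x + (\<Sum>i<m. y (i, n))\<^sup>2 / (4 * real m)"
    for x y :: "nat \<times> nat \<Rightarrow> real"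
    by (simp add: merge_def I_def J_def)
  have "(\<integral>\<^sup>+ X. ennreal (exp (?F (Suc n) X)) \<partial>gauss_matrix m (Suc n))
    = (\<integral>\<^sup>+ x. \<integral>\<^sup>+ y. ennreal (exp (?F (Suc n) (merge I J (x, y)))) \<partial>Pi\<^sub>M J (\<lambda>_. std_normal) \<partial>Pi\<^sub>M I (\<lambda>_. std_normal))"
    unfolding gauss_matrix_def IJ_eq by (rule product_nn_integral_fold[OF IJ F])
  also have "\<dots> = (\<integral>\<^sup>+ x. ennreal (exp (?F n x)) * (\<integral>\<^sup>+ y. ennreal (exp ((\<Sum>i<m. y (i, n))\<^sup>2 / (4 * real m)))
      \<partial>Pi\<^sub>M J (\<lambda>_. std_normal)) \<partial>Pi\<^sub>M I (\<lambda>_. std_normal))"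
  proof (rule nn_integral_cong)
    fix x
    have [measurable]: "(\<lambda>X. X (i, n)) \<in> borel_measurable (Pi\<^sub>M J (\<lambda>_. std_normal))" if "i < m" for i
      using that by (intro measurable_PiM_std_normal_component) (auto simp: J_def)
    show "(\<integral>\<^sup>+ y. ennreal (exp (?F (Suc n) (merge I J (x, y)))) \<partial>Pi\<^sub>M J (\<lambda>_. std_normal))
      = ennreal (exp (?F n x)) * (\<integral>\<^sup>+ y. ennreal (exp ((\<Sum>i<m. y (i, n))\<^sup>2 / (4 * real m))) \<partial>Pi\<^sub>M J (\<lambda>_. std_normal))"
      unfolding merge by (subst nn_integral_cmult[symmetric]) (auto simp: exp_add ennreal_mult)
  qed
  also have "\<dots> = (\<integral>\<^sup>+ x. ennreal (exp (?F n x)) \<partial>Pi\<^sub>M I (\<lambda>_. std_normal)) * ennreal (sqrt 2)"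
    unfolding J_def nn_integral_exp_column_sum_sq[OF assms] by (rule nn_integral_multc) measurable
  also have "\<dots> = ennreal (sqrt 2 ^ Suc n)"
    using Suc.IH by (simp add: gauss_matrix_def I_def[symmetric] mult.commute flip: ennreal_mult)
  finally show ?case .
qed

text \<open>The exponent is \<open>2 * l\<close> times the inner product of \<open>v\<close> with
  the vector of column sums. Completing the square separates it into
  \<open>4 * l\<^sup>2 * m\<close> times the squared length of \<open>v\<close>, which is 1, and a
  term independent of \<open>v\<close>. The maximum therefore costs \<open>sqrt 2 ^ n\<close>,
  whatever the cardinality of \<open>T\<close>.\<close>

lemma nn_integral_exp_Max_linear_gauss_matrix:
  assumes T: "finite T" "T \<noteq> {}" and m: "m > 0"
    and unit: "\<And>v. v \<in> T \<Longrightarrow> (\<Sum>j<n. (v j)\<^sup>2) = 1"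
  shows "(\<integral>\<^sup>+ X. ennreal (exp (Max ((\<lambda>v. 2 * l * (\<Sum>i<m. mat_vec n X v i)) ` T))) \<partial>gauss_matrix m n)
      \<le> ennreal (exp (4 * l\<^sup>2 * real m) * sqrt 2 ^ n)"
proof -
  let ?S = "\<lambda>X j. \<Sum>i<m. X (i, j)"
  have le: "Max ((\<lambda>v. 2 * l * (\<Sum>i<m. mat_vec n X v i)) ` T)
      \<le> 4 * l\<^sup>2 * real m + (\<Sum>j<n. (?S X j)\<^sup>2 / (4 * real m))" for X
  proof (rule Max.boundedI)
    fix z assume "z \<in> (\<lambda>v. 2 * l * (\<Sum>i<m. mat_vec n X v i)) ` T"
    then obtain v where v: "v \<in> T" "z = 2 * l * (\<Sum>i<m. mat_vec n X v i)" by auto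
    have "(\<Sum>i<m. mat_vec n X v i) = (\<Sum>j<n. v j * ?S X j)"
      unfolding mat_vec_def by (subst sum.swap) (simp add: sum_distrib_left mult.commute)
    then have "z = (\<Sum>j<n. 2 * l * (v j * ?S X j))"
      by (simp add: v(2) sum_distrib_left)
    also have "\<dots> \<le> (\<Sum>j<n. 4 * l\<^sup>2 * real m * (v j)\<^sup>2 + (?S X j)\<^sup>2 / (4 * real m))"
    proof (rule sum_mono)
      fix j
      have "0 \<le> (4 * l * m * v j - ?S X j)\<^sup>2 / (4 * real m)" by simp
      also have "\<dots> = 4 * l\<^sup>2 * real m * (v j)\<^sup>2 + (?S X j)\<^sup>2 / (4 * real m) - 2 * l * (v j * ?S X j)"
        using m by (simp add: field_simps power2_eq_square)
      finally show "2 * l * (v j * ?S X j) \<le> 4 * l\<^sup>2 * real m * (v j)\<^sup>2 + (?S X j)\<^sup>2 / (4 * real m)"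
        by simp
    qed
    also have "\<dots> = 4 * l\<^sup>2 * real m * (\<Sum>j<n. (v j)\<^sup>2) + (\<Sum>j<n. (?S X j)\<^sup>2 / (4 * real m))"
      by (simp add: sum.distrib sum_distrib_left)
    finally show "z \<le> 4 * l\<^sup>2 * real m + (\<Sum>j<n. (?S X j)\<^sup>2 / (4 * real m))"
      using unit[OF v(1)] by simp
  qed (use T in auto)
  have [measurable]: "(\<lambda>X. X (i, j)) \<in> borel_measurable (gauss_matrix m n)" if "i < m" "j < n" for i j
    using that unfolding gauss_matrix_def by (intro measurable_PiM_std_normal_component) auto
  have "(\<integral>\<^sup>+ X. ennreal (exp (Max ((\<lambda>v. 2 * l * (\<Sum>i<m. mat_vec n X v i)) ` T))) \<partial>gauss_matrix m n)
    \<le> (\<integral>\<^sup>+ X. ennreal (exp (4 * l\<^sup>2 * real m)) * ennreal (exp (\<Sum>j<n. (?S X j)\<^sup>2 / (4 * real m))) \<partial>gauss_matrix m n)"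
    using le by (intro nn_integral_mono) (simp flip: ennreal_mult exp_add)
  also have "\<dots> = ennreal (exp (4 * l\<^sup>2 * real m)) * ennreal (sqrt 2 ^ n)"
    by (subst nn_integral_cmult) (auto simp: nn_integral_exp_column_sums_sq[OF m])
  finally show ?thesis by (simp add: ennreal_mult)
qed

section \<open>The tent function\<close>

text \<open>The two branches reflect what a row contributes: \<open>\<bar>x\<bar>\<close> if intact,
  and \<open>- \<bar>x\<bar>\<close>, raised by the charge \<open>2 * t\<close>, if
  corrupted.\<close>

definition tent :: "real \<Rightarrow> real \<Rightarrow> real" where
  "tent t x = min \<bar>x\<bar> (2 * t - \<bar>x\<bar>)"

lemma tent_lipschitz: "\<bar>tent t x - tent t y\<bar> \<le> \<bar>x - y\<bar>"
  unfolding tent_def by linarith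

text \<open>An antiderivative is \<open>- std_normal_density\<close>; \<open>0 \<le> a\<close> makes
  the integrand nonnegative on the half-line.\<close>

lemma has_bochner_integral_std_normal_first_moment_tail:
  assumes "0 \<le> a"
  shows "has_bochner_integral lborel (\<lambda>x. std_normal_density x * x * indicator {a..} x) (std_normal_density a)"
proof (rule has_bochner_integral_nn_integral)
  have "(\<integral>\<^sup>+ x. ennreal (std_normal_density x * x) * indicator {a..} x \<partial>lborel)
      = ennreal (0 - (- std_normal_density a))"
  proof (rule nn_integral_FTC_atLeast)
    fix x assume "a \<le> x"
    show "DERIV (\<lambda>x. - std_normal_density x) x :> std_normal_density x * x"
      unfolding std_normal_density_def
      by (auto intro!: derivative_eq_intros simp: field_simps)
    show "0 \<le> std_normal_density x * x" using assms \<open>a \<le> x\<close> by simp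
  next
    have "((\<lambda>x::real. exp (- (x\<^sup>2 / 2))) \<longlongrightarrow> 0) at_top"
      by (intro filterlim_compose[OF exp_at_bot] filterlim_compose[OF filterlim_uminus_at_bot_at_top]
          filterlim_at_top_mult_tendsto_pos[OF tendsto_const, of "1/2", simplified]
          filterlim_pow_at_top filterlim_ident) auto
    then have "((\<lambda>x. - (1 / sqrt (2 * pi) * exp (- (x\<^sup>2 / 2)))) \<longlongrightarrow> - (1 / sqrt (2 * pi) * 0)) at_top"
      by (intro tendsto_intros)
    then show "((\<lambda>x. - std_normal_density x) \<longlongrightarrow> 0) at_top"
      unfolding std_normal_density_def by simp
  qed simp
  moreover have "ennreal (std_normal_density x * x) * indicator {a..} x
      = ennreal (std_normal_density x * x * indicator {a..} x)" for x
    by (simp split: split_indicator)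
  ultimately show "(\<integral>\<^sup>+ x. ennreal (std_normal_density x * x * indicator {a..} x) \<partial>lborel)
      = ennreal (std_normal_density a)"
    by simp
qed (use assms in \<open>auto split: split_indicator\<close>)

lemma has_bochner_integral_std_normal_tail:
  "has_bochner_integral lborel (\<lambda>x. std_normal_density x * indicator {a<..} x) (1 - Phi a)"
proof (rule has_bochner_integral_nn_integral)
  interpret prob_space std_normal by (rule prob_space_std_normal)
  have "prob (space std_normal - {..a}) = 1 - Phi a"
    unfolding Phi_def by (rule prob_compl) simp
  moreover have "space std_normal - {..a} = {a<..}" by auto
  ultimately have P: "prob {a<..} = 1 - Phi a" by simp
  then show "0 \<le> 1 - Phi a" using measure_nonneg[of std_normal "{a<..}"] by simp
  have "(\<integral>\<^sup>+ x. ennreal (std_normal_density x * indicator {a<..} x) \<partial>lborel)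
      = (\<integral>\<^sup>+ x. ennreal (std_normal_density x) * indicator {a<..} x \<partial>lborel)"
    by (intro nn_integral_cong) (simp split: split_indicator)
  also have "\<dots> = emeasure std_normal {a<..}"
    unfolding std_normal_def by (subst emeasure_density) auto
  finally show "(\<integral>\<^sup>+ x. ennreal (std_normal_density x * indicator {a<..} x) \<partial>lborel) = ennreal (1 - Phi a)"
    by (simp add: emeasure_eq_measure P)
qed (auto split: split_indicator)

lemma integral_tent_std_normal:
  assumes t: "t = sqrt (2 * ln 2)"
  shows "(\<integral>x. tent t x \<partial>std_normal) = 2 * t * eta0"
proof -
  have "0 \<le> t" by (simp add: t)
  \<comment> \<open>Here the value of \<open>t\<close> matters: since
    \<open>exp (- t\<^sup>2 / 2) = 1 / 2\<close>, the two density terms below cancel and only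
    \<open>2 * t * (1 - Phi t) = t * eta0\<close> remains.\<close>
  have "std_normal_density t = std_normal_density 0 / 2"
    by (simp add: t std_normal_density_def exp_minus)
  let ?f = "\<lambda>x. std_normal_density x * x * indicator {0..} x - 2 * (std_normal_density x * x * indicator {t..} x)
        + 2 * t * (std_normal_density x * indicator {t<..} x)"
  have "has_bochner_integral lborel ?f (std_normal_density 0 - 2 * std_normal_density t + 2 * t * (1 - Phi t))"
    using \<open>0 \<le> t\<close>
    by (intro has_bochner_integral_add has_bochner_integral_diff has_bochner_integral_mult_right
        has_bochner_integral_std_normal_first_moment_tail has_bochner_integral_std_normal_tail) auto
  also have "std_normal_density 0 - 2 * std_normal_density t + 2 * t * (1 - Phi t) = t * eta0"
    unfolding \<open>std_normal_density t = _\<close> by (simp add: eta0_def t)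
  also have "has_bochner_integral lborel ?f (t * eta0) \<longleftrightarrow>
      has_bochner_integral lborel (\<lambda>x. indicator {0..} x *\<^sub>R (std_normal_density x * tent t x)) (t * eta0)"
  proof (rule has_bochner_integral_cong_AE)
    \<comment> \<open>At \<open>x = t\<close> the closed and the open tail indicator disagree, so
      the identity holds only off a null set.\<close>
    show "AE x in lborel. ?f x = indicator {0..} x *\<^sub>R (std_normal_density x * tent t x)"
      using AE_lborel_singleton[of t]
      by eventually_elim (use \<open>0 \<le> t\<close> in \<open>auto simp: tent_def min_def algebra_simps split: split_indicator\<close>)
  qed (auto simp: tent_def)
  finally have "has_bochner_integral lborel (\<lambda>x. std_normal_density x * tent t x) (2 *\<^sub>R (t * eta0))"
    by (rule has_bochner_integral_even_function) (simp add: tent_def std_normal_density_def)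
  then have "(\<integral>x. std_normal_density x * tent t x \<partial>lborel) = 2 * t * eta0"
    by (simp add: has_bochner_integral_iff)
  moreover have "tent t \<in> borel_measurable borel"
    unfolding tent_def by measurable
  ultimately show ?thesis
    unfolding std_normal_def by (subst integral_density) auto
qed

section \<open>Uniform lower tail and recovery\<close>

text \<open>Exponential Markov inequality for the maximum of the centred sums, followed by the
  comparison with the linear process. The bound is free of the cardinality of \<open>T\<close>,
  which lets it pass to countable sets.\<close>

lemma emeasure_small_sum_finite:
  fixes g :: "real \<Rightarrow> real" and T :: "(nat \<Rightarrow> real) set"
  assumes T: "finite T" and m: "m > 0" and s: "0 \<le> s"
    and unit: "\<And>v. v \<in> T \<Longrightarrow> (\<Sum>j<n. (v j)\<^sup>2) = 1"
    and g0: "g 0 = 0" and lip: "\<And>x y. \<bar>g x - g y\<bar> \<le> \<bar>x - y\<bar>"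
    and g_meas [measurable]: "g \<in> borel_measurable borel"
    and \<mu>: "\<mu> = (\<integral>y. g y \<partial>std_normal)"
  shows "emeasure (gauss_matrix m n)
      {X \<in> space (gauss_matrix m n). \<exists>v\<in>T. (\<Sum>i<m. g (mat_vec n X v i)) < real m * (\<mu> - s)}
    \<le> ennreal (exp (- real m * s\<^sup>2 / 16) * sqrt 2 ^ n)" (is "emeasure ?M ?B \<le> _")
proof (cases "T = {}")
  case False
  \<comment> \<open>This choice minimizes \<open>- l * m * s + 4 * l\<^sup>2 * m\<close>, with value
    \<open>- m * s\<^sup>2 / 16\<close>.\<close>
  define l where "l = s / 8"
  have l: "0 \<le> l" using s by (simp add: l_def)
  have [measurable]: "(\<lambda>X. mat_vec n X v i) \<in> borel_measurable ?M" if "i < m" for v i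
    unfolding gauss_matrix_def using that by (intro measurable_mat_vec) auto
  let ?u = "\<lambda>X. exp (Max ((\<lambda>v. 0 + l * (\<Sum>i<m. \<mu> - g (mat_vec n X v i))) ` T))"
  let ?c = "exp (- (l * real m * s))"
  have [measurable]: "?u \<in> borel_measurable ?M"
    using T by measurable
  have "?B \<subseteq> {X \<in> space ?M. 1 \<le> ennreal ?c * ennreal (?u X)}"
  proof safe
    fix X v assume v: "v \<in> T" "(\<Sum>i<m. g (mat_vec n X v i)) < real m * (\<mu> - s)"
    have "l * (real m * s) \<le> l * (\<Sum>i<m. \<mu> - g (mat_vec n X v i))"
      using v(2) l by (intro mult_left_mono) (auto simp: sum_subtractf algebra_simps)
    also have "\<dots> \<le> Max ((\<lambda>v. 0 + l * (\<Sum>i<m. \<mu> - g (mat_vec n X v i))) ` T)"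
      using T v(1) by (auto intro: Max_ge)
    finally have "1 \<le> ?c * ?u X"
      by (simp add: mult.assoc flip: exp_add)
    then show "1 \<le> ennreal ?c * ennreal (?u X)"
      by (simp flip: ennreal_mult)
  qed
  then have "emeasure ?M ?B \<le> emeasure ?M {X \<in> space ?M. 1 \<le> ennreal ?c * ennreal (?u X)}"
    by (rule emeasure_mono) measurable
  also have "\<dots> \<le> ennreal ?c * (\<integral>\<^sup>+ X. ennreal (?u X) * indicator (space ?M) X \<partial>?M)"
  proof (rule nn_integral_Markov_inequality)
    show "(\<lambda>X. ennreal (?u X) * indicator (space ?M) X) \<in> borel_measurable ?M"
      by measurable
  qed auto
  also have "(\<integral>\<^sup>+ X. ennreal (?u X) * indicator (space ?M) X \<partial>?M) = (\<integral>\<^sup>+ X. ennreal (?u X) \<partial>?M)"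
    by (intro nn_integral_cong) simp
  also have "\<dots> \<le> (\<integral>\<^sup>+ X. ennreal (exp (Max ((\<lambda>v. 0 + 2 * l * (\<Sum>i<m. mat_vec n X v i)) ` T))) \<partial>?M)"
    using T False l unit g0 lip g_meas \<mu> by (rule exp_Max_comparison_gauss_matrix)
  also have "\<dots> \<le> ennreal (exp (4 * l\<^sup>2 * real m) * sqrt 2 ^ n)"
    using nn_integral_exp_Max_linear_gauss_matrix[OF T False m unit] by simp
  also have "ennreal ?c * ennreal (exp (4 * l\<^sup>2 * real m) * sqrt 2 ^ n)
      = ennreal (exp (- (l * real m * s) + 4 * l\<^sup>2 * real m) * sqrt 2 ^ n)"
    unfolding exp_add by (simp add: mult.assoc flip: ennreal_mult)
  also have "- (l * real m * s) + 4 * l\<^sup>2 * real m = - real m * s\<^sup>2 / 16"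
    by (simp add: l_def power2_eq_square)
  finally show ?thesis
    by (simp add: mult_left_mono)
qed simp

text \<open>Initial segments of an enumeration exhaust \<open>D\<close> increasingly, and the finite
  bound is uniform over them, so continuity from below applies.\<close>

lemma emeasure_small_sum_countable:
  fixes g :: "real \<Rightarrow> real" and D :: "(nat \<Rightarrow> real) set"
  assumes D: "countable D" and m: "m > 0" and s: "0 \<le> s"
    and unit: "\<And>v. v \<in> D \<Longrightarrow> (\<Sum>j<n. (v j)\<^sup>2) = 1"
    and g0: "g 0 = 0" and lip: "\<And>x y. \<bar>g x - g y\<bar> \<le> \<bar>x - y\<bar>"
    and g_meas [measurable]: "g \<in> borel_measurable borel"
    and \<mu>: "\<mu> = (\<integral>y. g y \<partial>std_normal)"
  defines "B \<equiv> {X \<in> space (gauss_matrix m n). \<exists>v\<in>D. (\<Sum>i<m. g (mat_vec n X v i)) < real m * (\<mu> - s)}"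
  shows "B \<in> sets (gauss_matrix m n)"
    and "emeasure (gauss_matrix m n) B \<le> ennreal (exp (- real m * s\<^sup>2 / 16) * sqrt 2 ^ n)"
proof -
  let ?M = "gauss_matrix m n"
  have [measurable]: "(\<lambda>X. mat_vec n X v i) \<in> borel_measurable ?M" if "i < m" for v i
    unfolding gauss_matrix_def using that by (intro measurable_mat_vec) auto
  show "B \<in> sets ?M"
    unfolding B_def using D by measurable
  show "emeasure ?M B \<le> ennreal (exp (- real m * s\<^sup>2 / 16) * sqrt 2 ^ n)"
  proof (cases "D = {}")
    case False
    define A where "A = (\<lambda>k. {X \<in> space ?M. \<exists>v\<in>from_nat_into D ` {..k::nat}.
        (\<Sum>i<m. g (mat_vec n X v i)) < real m * (\<mu> - s)})"
    have "B = (\<Union>k. A k)"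
    proof -
      have mem: "v \<in> D \<longleftrightarrow> (\<exists>k. v \<in> from_nat_into D ` {..k})" for v
        using from_nat_into_surj[OF D, of v] from_nat_into[OF False] by force
      show ?thesis
        unfolding A_def B_def Bex_def mem by blast
    qed
    then have "emeasure ?M B = (SUP k. emeasure ?M (A k))"
    proof (simp, intro SUP_emeasure_incseq[symmetric])
      show "range A \<subseteq> sets ?M" unfolding A_def by (auto, measurable)
      show "incseq A" unfolding A_def by (force simp: incseq_def)
    qed
    also have "\<dots> \<le> ennreal (exp (- real m * s\<^sup>2 / 16) * sqrt 2 ^ n)"
      unfolding A_def using from_nat_into[OF False] unit
      by (intro SUP_least emeasure_small_sum_finite[OF _ m s _ g0 lip g_meas \<mu>]) auto
    finally show ?thesis .
  qed (simp add: B_def)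
qed

section \<open>Deterministic recovery from the uniform lower bound\<close>

text \<open>Let \<open>h\<close> be the error vector. The sum of the
  \<open>\<bar>mat_vec n X h i\<bar>\<close>, with corrupted rows counted negatively, is at least
  \<open>eps * m * norm2 n h\<close> by \<open>large\<close> and at most
  \<open>2 * norm1 m d\<close> by optimality; this is the origin of the constant 2.\<close>

lemma good_matrixI:
  assumes eps: "eps > 0" and m: "m > 0" and eta: "eta < eta0 - eps" and t: "1 \<le> t"
    and large: "\<And>v. (\<Sum>j<n. (v j)\<^sup>2) = 1 \<Longrightarrow>
      real m * (2 * t * eta0 - t * eps) \<le> (\<Sum>i<m. tent t (mat_vec n X v i))"
  shows "good_matrix m n eta eps 2 X"
  unfolding good_matrix_def Let_def
proof (intro allI impI)
  fix wstar zeta d what :: "nat \<Rightarrow> real"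
  assume sparse: "real (norm0 m zeta) \<le> eta * real m"
  assume opt: "\<forall>w. norm1 m (\<lambda>i. mat_vec n X wstar i + d i + zeta i - mat_vec n X what i)
    \<le> norm1 m (\<lambda>i. mat_vec n X wstar i + d i + zeta i - mat_vec n X w i)"
  define h where "h = (\<lambda>j. what j - wstar j)"
  define r where "r = norm2 n h"
  define \<sigma> where "\<sigma> = (\<lambda>i. if zeta i = 0 then 1 else - 1 :: real)"
  have Xh: "mat_vec n X h i = mat_vec n X what i - mat_vec n X wstar i" for i
    by (simp add: mat_vec_def h_def algebra_simps sum_subtractf)
  have "0 \<le> r" by (simp add: r_def norm2_def sum_nonneg)
  have "eps * real m * r \<le> (\<Sum>i<m. \<sigma> i * \<bar>mat_vec n X h i\<bar>)"
  proof (cases "r = 0")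
    case True
    then have "(\<Sum>j<n. (h j)\<^sup>2) = 0" by (simp add: r_def norm2_def)
    then have "h j = 0" if "j < n" for j
      using that by (subst (asm) sum_nonneg_eq_0_iff) auto
    then show ?thesis using True by (simp add: mat_vec_def)
  next
    case False
    with \<open>0 \<le> r\<close> have r: "0 < r" by simp
    let ?v = "\<lambda>j. h j / r"
    have "(\<Sum>j<n. (h j)\<^sup>2) = r\<^sup>2"
      by (simp add: r_def norm2_def sum_nonneg)
    then have unit: "(\<Sum>j<n. (?v j)\<^sup>2) = 1"
      using r by (simp add: power_divide flip: sum_divide_distrib)
    have Xv: "mat_vec n X ?v i = mat_vec n X h i / r" for i
      by (simp add: mat_vec_def sum_divide_distrib)
    have "real m * (2 * t * eta0 - t * eps) \<le> (\<Sum>i<m. tent t (mat_vec n X ?v i))"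
      by (rule large[OF unit])
    \<comment> \<open>Intact rows use the first branch of \<open>tent\<close>, corrupted rows the
      second, each at a charge of \<open>2 * t\<close>.\<close>
    also have "\<dots> \<le> (\<Sum>i<m. \<sigma> i * \<bar>mat_vec n X ?v i\<bar> + (if zeta i \<noteq> 0 then 2 * t else 0))"
      by (intro sum_mono) (auto simp: tent_def \<sigma>_def)
    also have "\<dots> = (\<Sum>i<m. \<sigma> i * \<bar>mat_vec n X ?v i\<bar>) + 2 * t * real (norm0 m zeta)"
      by (simp add: sum.distrib norm0_def sum.If_cases Int_def)
    also have "2 * t * real (norm0 m zeta) \<le> 2 * t * (eta * real m)"
      using sparse t by (intro mult_left_mono) auto
    finally have "real m * (t * (2 * (eta0 - eta) - eps)) \<le> (\<Sum>i<m. \<sigma> i * \<bar>mat_vec n X ?v i\<bar>)"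
      by (simp add: algebra_simps)
    \<comment> \<open>The gap \<open>eta0 - eta > eps\<close> outweighs the loss \<open>eps\<close>
      when doubled, and \<open>t \<ge> 1\<close> removes the factor \<open>t\<close>.\<close>
    moreover have "1 * eps \<le> t * (2 * (eta0 - eta) - eps)"
      using eps eta t by (intro mult_mono) auto
    then have "real m * eps \<le> real m * (t * (2 * (eta0 - eta) - eps))"
      by (intro mult_left_mono) auto
    ultimately have "real m * eps \<le> (\<Sum>i<m. \<sigma> i * \<bar>mat_vec n X ?v i\<bar>)" by linarith
    also have "\<dots> = (\<Sum>i<m. \<sigma> i * \<bar>mat_vec n X h i\<bar>) / r"
      using r by (simp add: Xv sum_divide_distrib)
    finally show ?thesis using r by (simp add: field_simps)
  qed
  moreover have "(\<Sum>i<m. \<sigma> i * \<bar>mat_vec n X h i\<bar>) \<le> 2 * norm1 m d"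
  proof -
    have "norm1 m (\<lambda>i. d i + zeta i) + (\<Sum>i<m. \<sigma> i * \<bar>mat_vec n X h i\<bar>) - 2 * norm1 m d
        = (\<Sum>i<m. \<bar>d i + zeta i\<bar> + \<sigma> i * \<bar>mat_vec n X h i\<bar> - 2 * \<bar>d i\<bar>)"
      by (simp add: norm1_def sum.distrib sum_subtractf sum_distrib_left)
    \<comment> \<open>Triangle inequality in each row, with \<open>x\<close> the entry of
      \<open>X h\<close>: \<open>\<bar>d - x\<bar> \<ge> \<bar>x\<bar> - \<bar>d\<bar>\<close> if
      the row is intact, and \<open>\<bar>d + zeta - x\<bar> \<ge> \<bar>d + zeta\<bar> -
      \<bar>x\<bar>\<close> if it is corrupted.\<close>
    also have "\<dots> \<le> (\<Sum>i<m. \<bar>d i + zeta i - mat_vec n X h i\<bar>)"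
      by (intro sum_mono) (auto simp: \<sigma>_def)
    \<comment> \<open>The competitor \<open>wstar\<close> in the minimization has residual
      \<open>d + zeta\<close>.\<close>
    also have "\<dots> \<le> norm1 m (\<lambda>i. d i + zeta i)"
      using opt[rule_format, of wstar] by (simp add: norm1_def Xh algebra_simps)
    finally show ?thesis by simp
  qed
  ultimately have "eps * real m * r \<le> 2 * norm1 m d" by linarith
  then show "norm2 n (\<lambda>j. what j - wstar j) \<le> 2 * norm1 m d / (eps * real m)"
    using eps m by (simp add: r_def h_def field_simps)
qed

text \<open>The event is the complement of \<open>B\<close>, which ranges over a countable dense set
  of directions and is therefore measurable; continuity extends its estimate to all unit
  vectors.\<close>

lemma ex_good_event:
  assumes eps: "eps > 0" and eta: "eta < eta0 - eps" and m: "real m > 16 * real n / eps\<^sup>2"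
  shows "\<exists>A\<in>sets (gauss_matrix m n).
    A \<subseteq> {X \<in> space (gauss_matrix m n). good_matrix m n eta eps 2 X} \<and>
    measure (gauss_matrix m n) A \<ge> 1 - exp (- (1 / 32) * eps\<^sup>2 * real m)"
proof -
  let ?M = "gauss_matrix m n"
  interpret prob_space ?M
    unfolding gauss_matrix_def by (rule prob_space_PiM_std_normal)
  define t where "t = sqrt (2 * ln 2)"
  have ln2: "1 / 2 \<le> ln (2::real)" "ln (2::real) \<le> 1"
    using ln_add_one_self_le_self[of 1] ln_one_minus_pos_upper_bound[of "1/2"]
    by (simp_all add: ln_div)
  have t: "1 \<le> t" "t\<^sup>2 = 2 * ln 2" using ln2 by (simp_all add: t_def)
  have "0 \<le> 16 * real n / eps\<^sup>2" by simp
  with m have "0 < real m" by linarith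
  then have m_pos: "m > 0" by simp
  have cont: "continuous_on UNIV (tent t)"
    unfolding tent_def by (intro continuous_intros)
  have tent_meas: "tent t \<in> borel_measurable borel"
    using cont by (rule borel_measurable_continuous_onI)
  \<comment> \<open>Separability refers to the product topology on
    \<open>nat \<Rightarrow> real\<close>; the set is a sphere in the first \<open>n\<close>
    coordinates and unrestricted in the others.\<close>
  obtain D :: "(nat \<Rightarrow> real) set" where D: "countable D" "D \<subseteq> {v. (\<Sum>j<n. (v j)\<^sup>2) = 1}"
      "{v. (\<Sum>j<n. (v j)\<^sup>2) = 1} \<subseteq> closure D"
    by (rule separable)
  \<comment> \<open>The allowed deviation from the mean \<open>2 * t * eta0\<close> is
    \<open>s = t * eps\<close>.\<close>
  define B where "B = {X \<in> space ?M. \<exists>v\<in>D. (\<Sum>i<m. tent t (mat_vec n X v i)) < real m * (2 * t * eta0 - t * eps)}"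
  have s: "0 \<le> t * eps" using t eps by simp
  have B: "B \<in> sets ?M" "emeasure ?M B \<le> ennreal (exp (- real m * (t * eps)\<^sup>2 / 16) * sqrt 2 ^ n)"
    unfolding B_def using D s tent_meas m_pos
    by (intro emeasure_small_sum_countable tent_lipschitz
        integral_tent_std_normal[OF t_def, symmetric]; force simp: tent_def t_def)+
  have "prob B \<le> exp (- real m * (t * eps)\<^sup>2 / 16) * sqrt 2 ^ n"
    using B(2) by (simp add: emeasure_eq_measure)
  also have "sqrt 2 ^ n = exp (real n * (ln 2 / 2))"
    by (simp add: exp_of_nat_mult ln_sqrt[symmetric])
  also have "exp (- real m * (t * eps)\<^sup>2 / 16) * exp (real n * (ln 2 / 2))
      = exp (real n * (ln 2 / 2) - real m * (t * eps)\<^sup>2 / 16)"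
    by (simp flip: exp_add)
  \<comment> \<open>Since \<open>t\<^sup>2 = 2 * ln 2 \<ge> 1\<close>, the decay exponent is at
    least \<open>eps\<^sup>2 * m / 16\<close>. The factor 16 in the sample size keeps the dimension
    term below \<open>n / 2 \<le> eps\<^sup>2 * m / 32\<close>, which leaves
    \<open>1 / 32\<close>.\<close>
  also have "\<dots> \<le> exp (- (1 / 32) * eps\<^sup>2 * real m)"
  proof -
    have "16 * real n \<le> eps\<^sup>2 * real m"
      using m eps by (simp add: field_simps)
    moreover have "real n * (ln 2 / 2) \<le> real n * (1 / 2)"
      using ln2 by (intro mult_left_mono) auto
    moreover have "1 * (eps\<^sup>2 * real m) \<le> 2 * ln 2 * (eps\<^sup>2 * real m)"
      using ln2 by (intro mult_right_mono) auto
    moreover have "real m * (t * eps)\<^sup>2 = 2 * ln 2 * (eps\<^sup>2 * real m)"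
      by (simp add: power_mult_distrib t)
    ultimately have "real n * (ln 2 / 2) - real m * (t * eps)\<^sup>2 / 16 \<le> - (1 / 32) * (eps\<^sup>2 * real m)"
      by linarith
    then show ?thesis by (simp add: mult.assoc)
  qed
  finally have prob_B: "prob B \<le> exp (- (1 / 32) * eps\<^sup>2 * real m)" .
  have "good_matrix m n eta eps 2 X" if X: "X \<in> space ?M - B" for X
  proof (rule good_matrixI[OF eps m_pos eta t(1)])
    fix v :: "nat \<Rightarrow> real"
    assume "(\<Sum>j<n. (v j)\<^sup>2) = 1"
    \<comment> \<open>For fixed \<open>X\<close> the inequality depends continuously on finitely
      many coordinates of \<open>v\<close>, so it is a closed condition and passes from
      \<open>D\<close> to its closure.\<close>
    let ?C = "{v. real m * (2 * t * eta0 - t * eps) \<le> (\<Sum>i<m. tent t (mat_vec n X v i))}"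
    have "closed ?C"
      unfolding mat_vec_def
      by (intro closed_Collect_le continuous_intros continuous_on_compose2[OF cont]
          continuous_on_product_coordinates) auto
    moreover have "D \<subseteq> ?C"
      using X by (auto simp: B_def not_less)
    ultimately have "closure D \<subseteq> ?C" by (rule closure_minimal[rotated])
    with D(3) \<open>(\<Sum>j<n. (v j)\<^sup>2) = 1\<close>
    show "real m * (2 * t * eta0 - t * eps) \<le> (\<Sum>i<m. tent t (mat_vec n X v i))"
      by blast
  qed
  then show ?thesis
    using B(1) prob_B by (intro bexI[of _ "space ?M - B"]) (auto simp: prob_compl)
qed

theorem theorem1p2:
  shows "\<exists>C>0. \<exists>c>0. \<exists>K>0. \<forall>eps eta m n.
     eps > 0 \<longrightarrow> eta < eta0 - eps \<longrightarrow> real m > C * real n / eps\<^sup>2 \<longrightarrow>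
     (\<exists>A\<in>sets (gauss_matrix m n).
        A \<subseteq> {X \<in> space (gauss_matrix m n). good_matrix m n eta eps K X} \<and>
        measure (gauss_matrix m n) A \<ge> 1 - exp (- c * eps\<^sup>2 * real m))"
  by (rule exI[of _ 16], rule conjI, simp, rule exI[of _ "1 / 32"], rule conjI, simp,
      rule exI[of _ 2], rule conjI, simp) (intro allI impI ex_good_event)

end
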